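(* Let $\mathcal{H}$ be a (real or complex) Hilbert space and let $A$ be a densely defined closed linear operator from a subspace $\mathcal{D}(A)\subseteq\mathcal{H}$ to $\mathcal{H}$ whose range $\mathcal{R}(A)$ is closed. Then the following are equivalent: (1) $\mathcal{R}(A)=\mathcal{R}(A^* )$; (2) $AA^\dagger=A^\dagger A$ on $\mathcal{D}(A)$, i.e. $AA^\dagger x=A^\dagger A x$ for all $x\in\mathcal{D}(A)$; (3) $\mathcal{N}(A)=\mathcal{N}(A^\dagger)$; (4) $\mathcal{N}(A)=\mathcal{N}(A^* )$; (5) $\mathcal{N}(A)^\perp=\mathcal{R}(A)$; (6) $\overline{C(A)}=\mathcal{R}(A)$; (7) $\mathcal{H}=\mathcal{R}(A)\oplus\mathcal{N}(A)$.
   Context: $\mathcal{N}(T)$ and $\mathcal{R}(T)$ denote the null space and range of an operator $T$, $\mathcal{D}(T)$ its domain, and $A^*$ the Hilbert space adjoint of the densely defined operator $A$. $M^\perp$ is the orthogonal complement of $M$, and $M\oplus N$ denotes the orthogonal direct sum of subspaces $M$ and $N$ (so (7) asserts in particular that $\mathcal{R}(A)$ and $\mathcal{N}(A)$ are orthogonal). The carrier of $A$ is $C(A)=\mathcal{D}(A)\cap\mathcal{N}(A)^\perp$. The Moore-Penrose inverse $A^\dagger$ of a densely defined closed operator $A$ is the operator with domain $\mathcal{D}(A^\dagger)=\mathcal{R}(A)\oplus\mathcal{R}(A)^\perp$ that associates to each $y\in\mathcal{D}(A^\dagger)$ the unique $A^\dagger y\in C(A)$ with $AA^\dagger y=Qy$,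 where $Q$ is the orthogonal projection of $\mathcal{H}$ onto $\overline{\mathcal{R}(A)}$. When $\mathcal{R}(A)$ is closed, $A^\dagger$ is a bounded operator defined on all of $\mathcal{H}$. *)

theory Defs
  imports "HOL-Analysis.Analysis" "HOL-Library.Set_Algebras"
begin

text \<open>
  Scalar fields. The class covers exactly \<open>\<real>\<close> and \<open>\<complex>\<close>: both are instances, and by
  \<open>real_or_complex_cases\<close> below there is nothing else.
\<close>

class real_or_complex = real_normed_field +
  fixes sconj :: "'a \<Rightarrow> 'a"
  assumes sconj_add: "sconj (x + y) = sconj x + sconj y"
    and sconj_mult: "sconj (x * y) = sconj x * sconj y"
    and mult_sconj_scaleR: "x * sconj x = (norm x)\<^sup>2 *\<^sub>R 1"

instantiation real :: real_or_complex
begin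
definition sconj_real :: "real \<Rightarrow> real" where "sconj_real x = x"
instance by standard (auto simp: sconj_real_def power2_eq_square)
end

instantiation complex :: real_or_complex
begin
definition sconj_complex :: "complex \<Rightarrow> complex" where "sconj_complex = cnj"
instance by standard (auto simp: sconj_complex_def complex_mult_cnj cmod_def scaleR_conv_of_real)
end

lemma mult_sconj: "x * sconj x = of_real ((norm (x :: 'k::real_or_complex))\<^sup>2)"
  by (simp add: mult_sconj_scaleR of_real_def)

lemma real_or_complex_sconj_one: "sconj (1 :: 'k::real_or_complex) = 1"
  using mult_sconj[of "1 :: 'k"] by simp

lemma real_or_complex_trace:
  fixes x :: "'k::real_or_complex"
  shows "\<exists>t. x + sconj x = of_real t"
proof -
  have "(x + 1) * sconj (x + 1) = x * sconj x + (x + sconj x) + 1"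
    by (simp add: sconj_add real_or_complex_sconj_one algebra_simps)
  hence "x + sconj x = of_real ((norm (x + 1))\<^sup>2 - (norm x)\<^sup>2 - 1)"
    by (simp add: mult_sconj algebra_simps)
  thus ?thesis by blast
qed

lemma real_or_complex_imag_part:
  fixes x :: "'k::real_or_complex"
  shows "x \<in> \<real> \<or> (\<exists>j a b. j * j = -1 \<and> x = of_real a + of_real b * j)"
proof -
  obtain t where t: "x + sconj x = of_real t" using real_or_complex_trace by blast
  define n where "n = (norm x)\<^sup>2"
  define w where "w = x - of_real (t/2)"
  define d where "d = t\<^sup>2/4 - n"
  have c: "sconj x = of_real t - x" using t by (simp add: algebra_simps)
  have q: "x * (of_real t - x) = of_real n" using mult_sconj[of x] by (simp add: c n_def)
  have "w * w = of_real t * of_real t / 4 - x * (of_real t - x)"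
    by (simp add: w_def field_simps)
  hence w: "w * w = of_real d" by (simp add: q d_def power2_eq_square)
  have x: "x = of_real (t/2) + w" by (simp add: w_def)
  show ?thesis
  proof (cases "d \<ge> 0")
    case True
    hence "w * w = of_real (sqrt d) * of_real (sqrt d)"
      unfolding w by (metis of_real_mult real_sqrt_mult_self abs_of_nonneg)
    hence "w = of_real (sqrt d) \<or> w = - of_real (sqrt d)" by (simp add: square_eq_iff)
    hence "w \<in> \<real>" by auto
    thus ?thesis using x by (metis Reals_add Reals_of_real)
  next
    case False
    define s where "s = sqrt (- d)"
    have s: "s > 0" "s * s = - d" using False by (auto simp: s_def)
    define j where "j = w / of_real s"
    have "j * j = of_real d / of_real (s * s)" by (simp add: j_def w)
    hence "j * j = -1" using s False by simp
    moreover have "x = of_real (t/2) + of_real s * j" using x s by (simp add: j_def)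
    ultimately show ?thesis by blast
  qed
qed

lemma real_or_complex_cases:
  "(UNIV :: 'k::real_or_complex set) = \<real> \<or>
   (\<exists>i::'k. i * i = -1 \<and> (\<forall>x. \<exists>a b. x = of_real a + of_real b * i))"
proof (cases "\<exists>i::'k. i * i = -1")
  case True
  then obtain i :: 'k where i: "i * i = -1" by blast
  have "\<exists>a b. x = of_real a + of_real b * i" for x :: 'k
    using real_or_complex_imag_part[of x]
  proof
    assume "x \<in> \<real>"
    then obtain r where "x = of_real r" by (auto elim: Reals_cases)
    hence "x = of_real r + of_real 0 * i" by simp
    thus ?thesis by blast
  next
    assume "\<exists>j a b. j * j = -1 \<and> x = of_real a + of_real b * j"
    then obtain j a b where j: "j * j = -1" "x = of_real a + of_real b * j" by blast
    have "j = i \<or> j = - i" using i j(1) square_eq_iff[of j i] by simp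
    hence "x = of_real a + of_real b * i \<or> x = of_real a + of_real (- b) * i" using j(2) by auto
    thus ?thesis by blast
  qed
  thus ?thesis using i by blast
next
  case False
  thus ?thesis using real_or_complex_imag_part by blast
qed

text \<open>
  Completeness, the norm topology, and the underlying real vector space come from class
  \<open>banach\<close>; the axioms \<open>sc_of_real\<close> and \<open>ip_norm\<close> tie them to the scalar multiplication and
  to the inner product.
\<close>

locale hilbert_space = vector_space sc
  for sc :: "'k::real_or_complex \<Rightarrow> 'a::banach \<Rightarrow> 'a" +
  fixes ip :: "'a \<Rightarrow> 'a \<Rightarrow> 'k"
  assumes sc_of_real: "sc (of_real r) x = r *\<^sub>R x"
    and ip_add_left: "ip (x + y) z = ip x z + ip y z"
    and ip_sc_left: "ip (sc c x) y = c * ip x y"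
    and ip_sconj: "ip y x = sconj (ip x y)"
    and ip_norm: "ip x x = of_real ((norm x)\<^sup>2)"

lemma hilbert_space_real_inner:
  "hilbert_space scaleR (inner :: 'a::{real_inner,banach} \<Rightarrow> 'a \<Rightarrow> real)"
  by unfold_locales
    (auto simp: sconj_real_def inner_commute power2_norm_eq_inner algebra_simps)

lemma hilbert_space_complex:
  "hilbert_space (*) (\<lambda>x y :: complex. x * cnj y)"
  by unfold_locales
    (auto simp: sconj_complex_def scaleR_conv_of_real algebra_simps complex_mult_cnj cmod_def)

definition orth_compl :: "('a \<Rightarrow> 'a \<Rightarrow> 'k::real_or_complex) \<Rightarrow> 'a set \<Rightarrow> 'a set" where
  "orth_compl ip M = {x. \<forall>y\<in>M. ip x y = 0}"

text \<open>\<open>S = M \<oplus> N\<close>, including the orthogonality of the two summands.\<close>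

definition is_orth_sum ::
    "('a \<Rightarrow> 'a \<Rightarrow> 'k::real_or_complex) \<Rightarrow> 'a::banach set \<Rightarrow> 'a set \<Rightarrow> 'a set \<Rightarrow> bool" where
  "is_orth_sum ip S M N \<longleftrightarrow> (\<forall>x\<in>M. \<forall>y\<in>N. ip x y = 0) \<and> S = M + N"

definition orth_proj :: "('a \<Rightarrow> 'a \<Rightarrow> 'k::real_or_complex) \<Rightarrow> 'a::banach set \<Rightarrow> 'a \<Rightarrow> 'a" where
  "orth_proj ip M y = (THE p. p \<in> M \<and> y - p \<in> orth_compl ip M)"

text \<open>
  An operator in \<open>\<H>\<close> is a partial function \<open>A :: 'a \<rightharpoonup> 'a\<close>, with domain \<open>dom A\<close>, range \<open>ran A\<close>
  and graph \<open>Map.graph A\<close>.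
\<close>

definition linear_op :: "('k::real_or_complex \<Rightarrow> 'a::banach \<Rightarrow> 'a) \<Rightarrow> ('a \<rightharpoonup> 'a) \<Rightarrow> bool" where
  "linear_op sc A \<longleftrightarrow> module.subspace sc (dom A) \<and>
     (\<forall>x y u v. A x = Some u \<longrightarrow> A y = Some v \<longrightarrow> A (x + y) = Some (u + v)) \<and>
     (\<forall>c x u. A x = Some u \<longrightarrow> A (sc c x) = Some (sc c u))"

definition densely_defined :: "('a::banach \<rightharpoonup> 'a) \<Rightarrow> bool" where
  "densely_defined A \<longleftrightarrow> closure (dom A) = UNIV"

definition closed_op :: "('a::banach \<rightharpoonup> 'a) \<Rightarrow> bool" where
  "closed_op A \<longleftrightarrow> closed (Map.graph A)"

definition null_space :: "('a::banach \<rightharpoonup> 'a) \<Rightarrow> 'a set" where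
  "null_space A = {x. A x = Some 0}"

definition op_carrier ::
    "('a \<Rightarrow> 'a \<Rightarrow> 'k::real_or_complex) \<Rightarrow> ('a::banach \<rightharpoonup> 'a) \<Rightarrow> 'a set" where
  "op_carrier ip A = dom A \<inter> orth_compl ip (null_space A)"

text \<open>
  \<open>z = A\<^sup>* y\<close> iff \<open>\<langle>A x, y\<rangle> = \<langle>x, z\<rangle>\<close> for all \<open>x\<close> in the domain of \<open>A\<close>; such a \<open>z\<close> is unique when
  \<open>A\<close> is densely defined.
\<close>

definition op_adjoint ::
    "('a \<Rightarrow> 'a \<Rightarrow> 'k::real_or_complex) \<Rightarrow> ('a::banach \<rightharpoonup> 'a) \<Rightarrow> ('a \<rightharpoonup> 'a)" where
  "op_adjoint ip A = (\<lambda>y.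
     if \<exists>z. \<forall>x u. A x = Some u \<longrightarrow> ip u y = ip x z
     then Some (THE z. \<forall>x u. A x = Some u \<longrightarrow> ip u y = ip x z)
     else None)"

definition mp_inverse ::
    "('a \<Rightarrow> 'a \<Rightarrow> 'k::real_or_complex) \<Rightarrow> ('a::banach \<rightharpoonup> 'a) \<Rightarrow> ('a \<rightharpoonup> 'a)" where
  "mp_inverse ip A = (\<lambda>y.
     if y \<in> ran A + orth_compl ip (ran A)
     then Some (THE x. x \<in> op_carrier ip A \<and> A x = Some (orth_proj ip (closure (ran A)) y))
     else None)"

end

theory Submission imports Defs begin

text \<open>
  By the closed range theorem, \<open>ran A\<^sup>* = N(A)\<^sup>\<bottom>\<close>, and this subspace is also the closure of the
  carrier. Moreover \<open>N(A\<^sup>*) = N(A\<^sup>\<dagger>) = ran A\<^sup>\<bottom>\<close>, the operator \<open>A A\<^sup>\<dagger>\<close> is the orthogonal projection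
  onto \<open>ran A\<close>, and \<open>A\<^sup>\<dagger> A\<close> is the restriction to the dense subspace \<open>dom A\<close> of the projection
  onto \<open>N(A)\<^sup>\<bottom>\<close>. Hence each condition says that \<open>ran A\<close> and \<open>N(A)\<^sup>\<bottom>\<close> coincide. The range of
  \<open>A\<^sup>*\<close> is closed because \<open>\<parallel>w\<parallel> \<le> c \<parallel>A\<^sup>* w\<parallel>\<close> for \<open>w \<in> ran A\<close>: the \<open>w\<close> in \<open>ran A\<close> with
  \<open>\<parallel>A\<^sup>* w\<parallel> \<le> 1\<close> are pointwise bounded on \<open>ran A\<close>, as \<open>\<bar>\<langle>A x, w\<rangle>\<bar> \<le> \<parallel>x\<parallel>\<close>.
\<close>

section \<open>Inner product identities and continuity of the inner product\<close>

context hilbert_space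
begin

lemma sconj_zero: "sconj (0::'k) = 0"
  using sconj_add[of "0::'k" 0] by simp

lemma sconj_minus: "sconj (- x) = - sconj (x::'k)"
  using sconj_add[of x "- x"] by (simp add: sconj_zero add_eq_0_iff)

lemma sconj_of_real: "sconj (of_real r :: 'k) = of_real r"
proof (cases "r = 0")
  case False
  have "of_real r * sconj (of_real r) = (of_real r * of_real r :: 'k)"
    by (simp add: mult_sconj power2_eq_square)
  then show ?thesis using False by simp
qed (simp add: sconj_zero)

lemma ip_add_right: "ip x (y + z) = ip x y + ip x z"
  by (metis ip_sconj ip_add_left sconj_add)

lemma ip_sc_right: "ip x (sc c y) = sconj c * ip x y"
  by (metis ip_sconj ip_sc_left sconj_mult)

lemma ip_minus_left: "ip (- x) y = - ip x y"
  using ip_sc_left[of "- 1" x y] by simp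

lemma ip_minus_right: "ip x (- y) = - ip x y"
  using ip_sc_right[of x "- 1" y] by (simp add: sconj_minus real_or_complex_sconj_one)

lemma ip_diff_left: "ip (x - y) z = ip x z - ip y z"
  using ip_add_left[of x "- y" z] by (simp add: ip_minus_left)

lemma ip_diff_right: "ip x (y - z) = ip x y - ip x z"
  using ip_add_right[of x y "- z"] by (simp add: ip_minus_right)

lemma ip_zero_left [simp]: "ip 0 x = 0"
  using ip_diff_left[of 0 0 x] by simp

lemma ip_zero_right [simp]: "ip x 0 = 0"
  using ip_diff_right[of x 0 0] by simp

lemma ip_self_eq_0_iff: "ip x x = 0 \<longleftrightarrow> x = 0"
  by (simp add: ip_norm)

lemma ip_eq_0_sym: "ip x y = 0 \<longleftrightarrow> ip y x = 0"
  by (metis ip_sconj sconj_zero)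

text \<open>The coefficient is chosen to make the remainder orthogonal to \<open>y\<close>, so
  pairing the remainder with itself reduces to pairing it with \<open>x\<close>. The identity yields
  both Cauchy-Schwarz and the orthogonality of closest-point residuals.\<close>

lemma norm_diff_component:
  assumes "y \<noteq> 0"
  shows "(norm (x - sc (ip x y / ip y y) y))\<^sup>2 = (norm x)\<^sup>2 - (norm (ip x y))\<^sup>2 / (norm y)\<^sup>2"
proof -
  define c where "c = ip x y / ip y y"
  have y: "ip y y \<noteq> 0" using assms by (simp add: ip_self_eq_0_iff)
  have "ip (x - sc c y) y = 0"
    using y by (simp add: ip_diff_left ip_sc_left c_def)
  then have "ip (x - sc c y) (x - sc c y) = ip x x - c * ip y x"
    by (simp add: ip_diff_right ip_sc_right ip_diff_left ip_sc_left)
  also have "c * ip y x = (ip x y * sconj (ip x y)) / ip y y"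
    using ip_sconj[of y x] by (simp add: c_def)
  also have "\<dots> = of_real ((norm (ip x y))\<^sup>2 / (norm y)\<^sup>2)"
    unfolding mult_sconj ip_norm by simp
  finally have "(of_real ((norm (x - sc c y))\<^sup>2) :: 'k) =
      of_real ((norm x)\<^sup>2 - (norm (ip x y))\<^sup>2 / (norm y)\<^sup>2)"
    unfolding ip_norm by simp
  then show ?thesis unfolding c_def of_real_eq_iff .
qed

lemma Cauchy_Schwarz: "norm (ip x y) \<le> norm x * norm y"
proof (cases "y = 0")
  case False
  have "(norm (ip x y))\<^sup>2 / (norm y)\<^sup>2 \<le> (norm x)\<^sup>2"
    using norm_diff_component[OF False, of x] zero_le_power2 by (smt (verit))
  then have "(norm (ip x y))\<^sup>2 \<le> (norm x * norm y)\<^sup>2"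
    using False by (simp add: divide_simps power_mult_distrib)
  then show ?thesis by (rule power2_le_imp_le) simp
qed simp

lemma pythagoras:
  assumes "ip x y = 0"
  shows "(norm (x + y))\<^sup>2 = (norm x)\<^sup>2 + (norm y)\<^sup>2"
proof -
  have "ip (x + y) (x + y) = ip x x + ip y y"
    using assms ip_eq_0_sym[of x y] by (simp add: ip_add_left ip_add_right)
  then show ?thesis unfolding ip_norm of_real_add[symmetric] of_real_eq_iff .
qed

lemma parallelogram:
  fixes x y :: 'a
  shows "(norm (x + y))\<^sup>2 + (norm (x - y))\<^sup>2 = 2 * (norm x)\<^sup>2 + 2 * (norm y)\<^sup>2"
proof -
  have "ip (x + y) (x + y) + ip (x - y) (x - y) = 2 * ip x x + 2 * ip y y"
    by (simp add: ip_add_left ip_add_right ip_diff_left ip_diff_right)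
  then have "(of_real ((norm (x + y))\<^sup>2 + (norm (x - y))\<^sup>2) :: 'k) =
     of_real (2 * (norm x)\<^sup>2 + 2 * (norm y)\<^sup>2)"
    unfolding ip_norm by simp
  then show ?thesis unfolding of_real_eq_iff .
qed

text \<open>Conjugation fixes real scalars, so \<open>ip\<close> is bilinear over the reals although
  only sesquilinear over the scalar field. That suffices to pass to limits in either
  argument.\<close>

lemma bounded_bilinear_ip: "bounded_bilinear ip"
proof
  fix x y r
  show "ip (r *\<^sub>R x) y = r *\<^sub>R ip x y"
    by (simp add: sc_of_real[symmetric] ip_sc_left scaleR_conv_of_real)
  show "ip x (r *\<^sub>R y) = r *\<^sub>R ip x y"
    by (simp add: sc_of_real[symmetric] ip_sc_right scaleR_conv_of_real sconj_of_real)
  show "\<exists>K. \<forall>a b. norm (ip a b) \<le> norm a * norm b * K"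
    using Cauchy_Schwarz by (intro exI[of _ 1]) simp
qed (simp_all add: ip_add_left ip_add_right)

lemmas tendsto_ip = bounded_bilinear.tendsto[OF bounded_bilinear_ip]
lemmas continuous_on_ip = bounded_bilinear.continuous_on[OF bounded_bilinear_ip]

section \<open>Orthogonal complements and projections\<close>

lemma subspace_orth_compl: "subspace (orth_compl ip M)"
  by (rule subspaceI) (auto simp: orth_compl_def ip_add_left ip_sc_left)

lemma closed_orth_compl: "closed (orth_compl ip M)"
proof -
  have "orth_compl ip M = (\<Inter>y\<in>M. {x. ip x y = 0})"
    by (auto simp: orth_compl_def)
  then show ?thesis
    by (auto intro!: closed_INT closed_Collect_eq continuous_on_ip continuous_intros)
qed

lemma orth_compl_inter: "x \<in> M \<Longrightarrow> x \<in> orth_compl ip M \<Longrightarrow> x = 0"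
  by (auto simp: orth_compl_def ip_self_eq_0_iff)

text \<open>If the residual had a nonzero component along some \<open>m\<close> in \<open>M\<close>,
  removing that component would shorten it, contradicting minimality.\<close>

lemma closest_point_orthogonal:
  assumes M: "subspace M" and p: "p \<in> M"
    and min: "\<And>m. m \<in> M \<Longrightarrow> norm (x - p) \<le> norm (x - m)"
  shows "x - p \<in> orth_compl ip M"
  unfolding orth_compl_def
proof (intro CollectI ballI)
  fix m assume m: "m \<in> M"
  show "ip (x - p) m = 0"
  proof (cases "m = 0")
    case False
    let ?c = "ip (x - p) m / ip m m"
    have "p + sc ?c m \<in> M" using M p m by (intro subspace_add subspace_scale)
    then have "(norm (x - p))\<^sup>2 \<le> (norm (x - p - sc ?c m))\<^sup>2"
      using min[of "p + sc ?c m"] by (simp add: algebra_simps)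
    then have "(norm (ip (x - p) m))\<^sup>2 / (norm m)\<^sup>2 \<le> 0"
      using norm_diff_component[OF False, of "x - p"] by simp
    then show ?thesis using False by (simp add: divide_le_0_iff)
  qed simp
qed

text \<open>A minimizing sequence is Cauchy by the parallelogram law, and its limit stays in the
  closed set \<open>M\<close>.\<close>

lemma closest_point_exists:
  assumes M: "subspace M" and cl: "closed M"
  shows "\<exists>p\<in>M. \<forall>m\<in>M. norm (x - p) \<le> norm (x - m)"
proof -
  define d where "d = (INF m\<in>M. norm (x - m))"
  have ne: "M \<noteq> {}" using subspace_0[OF M] by auto
  have bdd: "bdd_below ((\<lambda>m. norm (x - m)) ` M)"
    by (rule bdd_belowI[of _ 0]) auto
  have d_le: "d \<le> norm (x - m)" if "m \<in> M" for m
    unfolding d_def using bdd that by (rule cINF_lower)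
  have d0: "0 \<le> d" unfolding d_def using ne by (intro cINF_greatest) auto
  have "\<exists>m\<in>M. norm (x - m) < d + e" if "e > 0" for e
  proof (rule ccontr)
    assume "\<not> ?thesis"
    then have "d + e \<le> (INF m\<in>M. norm (x - m))"
      by (intro cINF_greatest[OF ne]) (auto simp: not_less)
    then have "d + e \<le> d" by (simp add: d_def)
    then show False using that by simp
  qed
  then have "\<forall>n. \<exists>m\<in>M. norm (x - m) < d + inverse (real (Suc n))" by simp
  then obtain f where fM: "\<And>n. f n \<in> M"
    and f: "\<And>n. norm (x - f n) < d + inverse (real (Suc n))" by metis
  have lim: "(\<lambda>n. norm (x - f n)) \<longlonglongrightarrow> d"
  proof (rule tendsto_sandwich[of "\<lambda>_. d" _ _ "\<lambda>n. d + inverse (real (Suc n))"])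
    show "(\<lambda>n. d + inverse (real (Suc n))) \<longlonglongrightarrow> d"
      using tendsto_add[OF tendsto_const[of d] LIMSEQ_inverse_real_of_nat] by simp
    show "\<forall>\<^sub>F n in sequentially. norm (x - f n) \<le> d + inverse (real (Suc n))"
      by (intro always_eventually allI less_imp_le f)
  qed (use d_le fM in auto)
  have lim2: "(\<lambda>n. (norm (x - f n))\<^sup>2) \<longlonglongrightarrow> d\<^sup>2"
    by (intro tendsto_power lim)
  have dist: "(norm (f m - f n))\<^sup>2 \<le> 2 * (norm (x - f m))\<^sup>2 + 2 * (norm (x - f n))\<^sup>2 - 4 * d\<^sup>2"
    for m n
  proof -
    \<comment> \<open>The midpoint of \<open>f m\<close> and \<open>f n\<close> lies in
      \<open>M\<close>, hence at distance at least \<open>d\<close> from \<open>x\<close>. This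
      bounds the sum term in the parallelogram law for \<open>x - f m\<close> and
      \<open>x - f n\<close> from below by \<open>4 * d^2\<close>.\<close>
    have mid: "sc (of_real (1/2)) (f m + f n) \<in> M"
      using fM M by (intro subspace_add subspace_scale)
    have "2 *\<^sub>R (x - (1/2) *\<^sub>R (f m + f n)) = (x - f m) + (x - f n)"
      by (simp add: algebra_simps scaleR_2)
    then have "norm ((x - f m) + (x - f n)) = 2 * norm (x - (1/2) *\<^sub>R (f m + f n))"
      by (metis norm_scaleR abs_numeral)
    also have "\<dots> \<ge> 2 * d" using d_le[OF mid] unfolding sc_of_real by simp
    finally have "(2 * d)\<^sup>2 \<le> (norm ((x - f m) + (x - f n)))\<^sup>2"
      using d0 by (intro power_mono) auto
    then show ?thesis
      using parallelogram[of "x - f m" "x - f n"]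
      by (simp add: norm_minus_commute power_mult_distrib)
  qed
  have "Cauchy f"
  proof (rule CauchyI)
    fix e :: real assume e: "e > 0"
    \<comment> \<open>The tolerance e^2/4 enters \<open>dist\<close> twice, each time with factor 2,
      and so adds up to e^2.\<close>
    then have "eventually (\<lambda>n. (norm (x - f n))\<^sup>2 < d\<^sup>2 + e\<^sup>2 / 4) sequentially"
      using order_tendstoD(2)[OF lim2] by simp
    then obtain N where N: "\<And>n. n \<ge> N \<Longrightarrow> (norm (x - f n))\<^sup>2 < d\<^sup>2 + e\<^sup>2 / 4"
      by (auto simp: eventually_sequentially)
    have "norm (f m - f n) < e" if "m \<ge> N" "n \<ge> N" for m n
    proof -
      have "(norm (f m - f n))\<^sup>2 < e\<^sup>2"
        using N[OF that(1)] N[OF that(2)] dist[of m n] by linarith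
      then show ?thesis using e by (simp add: power2_less_imp_less)
    qed
    then show "\<exists>M. \<forall>m\<ge>M. \<forall>n\<ge>M. norm (f m - f n) < e" by blast
  qed
  then obtain p where p: "f \<longlonglongrightarrow> p"
    using Cauchy_convergent_iff convergent_def by blast
  have "p \<in> M" using cl fM p by (rule closed_sequentially)
  moreover have "norm (x - p) = d"
    using tendsto_norm[OF tendsto_diff[OF tendsto_const p]] lim by (rule LIMSEQ_unique)
  ultimately show ?thesis using d_le by auto
qed

lemma orth_proj:
  assumes M: "subspace M" and cl: "closed M"
  shows orth_proj_in: "orth_proj ip M x \<in> M"
    and orth_proj_diff: "x - orth_proj ip M x \<in> orth_compl ip M"
proof -
  obtain p where p: "p \<in> M \<and> x - p \<in> orth_compl ip M"
    using closest_point_exists[OF assms, of x] closest_point_orthogonal[OF M] by metis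
  have "q = p" if "q \<in> M \<and> x - q \<in> orth_compl ip M" for q
  proof -
    have "q - p \<in> M" using p that M by (intro subspace_diff) auto
    moreover have "(x - p) - (x - q) \<in> orth_compl ip M"
      using p that subspace_diff[OF subspace_orth_compl] by blast
    ultimately show ?thesis using orth_compl_inter[of "q - p" M] by simp
  qed
  then have "orth_proj ip M x \<in> M \<and> x - orth_proj ip M x \<in> orth_compl ip M"
    unfolding orth_proj_def by (rule theI[of "\<lambda>p. p \<in> M \<and> x - p \<in> orth_compl ip M", OF p])
  then show "orth_proj ip M x \<in> M" "x - orth_proj ip M x \<in> orth_compl ip M" by auto
qed

lemma orth_proj_unique:
  assumes M: "subspace M" and "closed M" and "p \<in> M" and "x - p \<in> orth_compl ip M"
  shows "orth_proj ip M x = p"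
proof -
  note P = orth_proj_in[OF assms(1,2), of x] orth_proj_diff[OF assms(1,2), of x]
  have "orth_proj ip M x - p \<in> M" using M P(1) assms(3) by (rule subspace_diff)
  moreover have "(x - p) - (x - orth_proj ip M x) \<in> orth_compl ip M"
    using subspace_orth_compl assms(4) P(2) by (rule subspace_diff)
  ultimately show ?thesis using orth_compl_inter[of "orth_proj ip M x - p" M] by simp
qed

text \<open>For the nontrivial inclusion, the residual of projecting \<open>x\<close> onto
  \<open>M\<close> lies in the complement of \<open>M\<close> and also in the double complement, so
  it vanishes. Closedness of \<open>M\<close> supplies the projection.\<close>

lemma orth_compl_orth_compl:
  assumes M: "subspace M" and "closed M"
  shows "orth_compl ip (orth_compl ip M) = M"
proof
  show "M \<subseteq> orth_compl ip (orth_compl ip M)"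
    unfolding orth_compl_def using ip_eq_0_sym by auto
  show "orth_compl ip (orth_compl ip M) \<subseteq> M"
  proof
    fix x assume x: "x \<in> orth_compl ip (orth_compl ip M)"
    let ?p = "orth_proj ip M x"
    note P = orth_proj_in[OF assms, of x] orth_proj_diff[OF assms, of x]
    have "?p \<in> orth_compl ip (orth_compl ip M)"
      using \<open>M \<subseteq> _\<close> P(1) by auto
    then have "x - ?p = 0"
      using x P(2) by (intro orth_compl_inter subspace_diff[OF subspace_orth_compl])
    then show "x \<in> M" using P(1) by simp
  qed
qed

lemma orth_compl_flip:
  assumes "subspace M" "closed M" "subspace L" "closed L"
  shows "orth_compl ip M = L \<longleftrightarrow> M = orth_compl ip L"
  using assms orth_compl_orth_compl by metis

lemma orth_proj_diff_eq:
  assumes "subspace M" "closed M"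
  shows "orth_proj ip (orth_compl ip M) x = x - orth_proj ip M x"
proof (rule orth_proj_unique[OF subspace_orth_compl closed_orth_compl])
  show "x - orth_proj ip M x \<in> orth_compl ip M" by (rule orth_proj_diff[OF assms])
  show "x - (x - orth_proj ip M x) \<in> orth_compl ip (orth_compl ip M)"
    using orth_proj_in[OF assms] by (simp add: orth_compl_orth_compl[OF assms])
qed

text \<open>A closed subspace is recovered as the fixed points of its projection; hence equal
  projections have equal ranges.\<close>

lemma orth_proj_id_iff:
  assumes "subspace M" "closed M"
  shows "orth_proj ip M x = x \<longleftrightarrow> x \<in> M"
  using orth_proj_in[OF assms, of x] orth_proj_unique[OF assms, of x x]
    subspace_0[OF subspace_orth_compl]
  by auto

lemma orth_proj_zero_iff:
  assumes "subspace M" "closed M"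
  shows "orth_proj ip M x = 0 \<longleftrightarrow> x \<in> orth_compl ip M"
  using orth_proj_diff[OF assms, of x] orth_proj_unique[OF assms subspace_0[OF assms(1)], of x]
  by auto

lemma orth_proj_diff_arg:
  assumes "subspace M" "closed M"
  shows "orth_proj ip M (x - y) = orth_proj ip M x - orth_proj ip M y"
proof (rule orth_proj_unique[OF assms])
  show "orth_proj ip M x - orth_proj ip M y \<in> M"
    by (intro subspace_diff assms orth_proj_in)
  have "x - y - (orth_proj ip M x - orth_proj ip M y) =
      (x - orth_proj ip M x) - (y - orth_proj ip M y)" by simp
  then show "x - y - (orth_proj ip M x - orth_proj ip M y) \<in> orth_compl ip M"
    using subspace_diff[OF subspace_orth_compl] orth_proj_diff[OF assms] by metis
qed

lemma norm_orth_proj_le: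
  assumes "subspace M" "closed M"
  shows "norm (orth_proj ip M x) \<le> norm x"
proof -
  let ?p = "orth_proj ip M x"
  have "ip (x - ?p) ?p = 0"
    using orth_proj_in[OF assms] orth_proj_diff[OF assms] by (auto simp: orth_compl_def)
  then have "(norm x)\<^sup>2 = (norm (x - ?p))\<^sup>2 + (norm ?p)\<^sup>2"
    using pythagoras[of "x - ?p" ?p] by simp
  then have "(norm ?p)\<^sup>2 \<le> (norm x)\<^sup>2" by simp
  then show ?thesis by (rule power2_le_imp_le) simp
qed

text \<open>The projection respects differences and does not increase norms, so it is Lipschitz with
  constant 1.\<close>

lemma tendsto_orth_proj:
  assumes M: "subspace M" "closed M" and f: "f \<longlonglongrightarrow> x"
  shows "(\<lambda>n. orth_proj ip M (f n)) \<longlonglongrightarrow> orth_proj ip M x"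
proof (rule LIM_zero_cancel, rule Lim_null_comparison)
  show "(\<lambda>n. norm (f n - x)) \<longlonglongrightarrow> 0"
    using f by (simp add: LIM_zero tendsto_norm_zero)
  show "\<forall>\<^sub>F n in sequentially.
      norm (orth_proj ip M (f n) - orth_proj ip M x) \<le> norm (f n - x)"
    using norm_orth_proj_le[OF M] by (simp add: orth_proj_diff_arg[OF M, symmetric])
qed

lemma ip_orth_proj_left:
  assumes "subspace M" "closed M" "y \<in> M"
  shows "ip (orth_proj ip M x) y = ip x y"
  using orth_proj_diff[OF assms(1,2), of x] assms(3)
  by (auto simp: orth_compl_def ip_diff_left)

text \<open>Banach-Steinhaus for the functionals given by pairing with elements of \<open>B\<close>.
  The closed sets \<open>S n\<close> of points where all of them are bounded by \<open>n\<close>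
  cover the space, so by Baire one of them contains a ball.\<close>

lemma uniform_boundedness:
  assumes "\<And>x. \<exists>c. \<forall>w\<in>B. norm (ip x w) \<le> c"
  shows "\<exists>c\<ge>0. \<forall>w\<in>B. norm w \<le> c"
proof -
  define S where "S n = {x. \<forall>w\<in>B. norm (ip x w) \<le> real n}" for n
  have cl: "closed (S n)" for n
  proof -
    have "S n = (\<Inter>w\<in>B. {x. norm (ip x w) \<le> real n})" by (auto simp: S_def)
    then show ?thesis
      by (auto intro!: closed_INT closed_Collect_le continuous_on_ip continuous_intros)
  qed
  have "x \<in> (\<Union>n. S n)" for x
  proof -
    obtain c where c: "\<forall>w\<in>B. norm (ip x w) \<le> c" using assms by blast
    obtain n where "c \<le> real n" using real_arch_simple by blast
    then have "x \<in> S n" using c by (force simp: S_def)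
    then show ?thesis by blast
  qed
  then have "(\<Union>n. S n) = UNIV" by blast
  moreover have "interior (\<Union>n. S n) = {}" if "\<And>n. interior (S n) = {}"
    using Baire_category_alt[of euclidean "range S"] that cl
    by (auto simp: completely_metrizable_space_euclidean)
  ultimately obtain n x where "x \<in> interior (S n)" by fastforce
  then obtain e where e: "e > 0" "ball x e \<subseteq> S n" by (auto simp: mem_interior)
  \<comment> \<open>The vector \<open>v\<close> is the multiple of \<open>w\<close> of norm e/2, so
    \<open>x\<close> and \<open>x + v\<close> both lie in the ball. Their difference gives a pairing
    of \<open>v\<close> with \<open>w\<close> of size at most 2n, while that pairing equals e/2
    times the norm of \<open>w\<close>.\<close>
  have "norm w \<le> 4 * real n / e" if w: "w \<in> B" for w
  proof (cases "w = 0")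
    case False
    define v where "v = (e / (2 * norm w)) *\<^sub>R w"
    have "norm v = e / 2" using False e by (simp add: v_def)
    then have "x + v \<in> S n" "x \<in> S n" using e by (auto simp: dist_norm)
    then have "norm (ip (x + v) w) \<le> real n" "norm (ip x w) \<le> real n"
      using w by (auto simp: S_def)
    then have "norm (ip v w) \<le> 2 * real n"
      using norm_triangle_ineq4[of "ip (x + v) w" "ip x w"] by (simp add: ip_add_left)
    moreover have "ip v w = of_real (e / 2 * norm w)"
    proof -
      have "ip v w = of_real (e / (2 * norm w)) * of_real ((norm w)\<^sup>2)"
        unfolding v_def sc_of_real[symmetric] ip_sc_left ip_norm ..
      also have "\<dots> = of_real (e / (2 * norm w) * (norm w)\<^sup>2)"
        by (simp only: of_real_mult)
      also have "e / (2 * norm w) * (norm w)\<^sup>2 = e / 2 * norm w"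
        using False by (simp add: power2_eq_square)
      finally show ?thesis .
    qed
    ultimately have "e / 2 * norm w \<le> 2 * real n"
      using e by (simp only: norm_of_real)
    then show ?thesis using e by (simp add: field_simps)
  qed (use e in auto)
  then show ?thesis using e by (intro exI[of _ "4 * real n / e"]) auto
qed

text \<open>Makes the projection theory available for the graph of an operator. The norm on pairs is
  Euclidean, so it is the one induced by the sum of the inner products.\<close>

lemma hilbert_space_prod:
  "hilbert_space (\<lambda>c (x, y). (sc c x, sc c y))
     (\<lambda>(x, y) (x', y'). ip x x' + ip y y')"
proof unfold_locales
  fix x y :: "'a \<times> 'a"
  show "(case y of (x, y) \<Rightarrow> \<lambda>(x', y'). ip x x' + ip y y') x =
     sconj ((case x of (x, y) \<Rightarrow> \<lambda>(x', y'). ip x x' + ip y y') y)"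
    using ip_sconj[of "fst y" "fst x"] ip_sconj[of "snd y" "snd x"]
    by (simp add: sconj_add case_prod_beta)
qed (auto simp: scale_right_distrib scale_left_distrib sc_of_real ip_add_left ip_sc_left
    ip_norm algebra_simps norm_prod_def split: prod.splits)

end

section \<open>Closed densely defined operators, their adjoint and carrier\<close>

locale closed_dense_operator = hilbert_space sc ip
  for sc :: "'k::real_or_complex \<Rightarrow> 'a::banach \<Rightarrow> 'a" and ip +
  fixes A :: "'a \<rightharpoonup> 'a"
  assumes linear: "linear_op sc A"
    and dense: "densely_defined A"
    and closed: "closed_op A"
begin

lemma A_add: "A x = Some u \<Longrightarrow> A y = Some v \<Longrightarrow> A (x + y) = Some (u + v)"
  using linear by (simp add: linear_op_def)

lemma A_sc: "A x = Some u \<Longrightarrow> A (sc c x) = Some (sc c u)"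
  using linear by (simp add: linear_op_def)

lemma A_diff: "A x = Some u \<Longrightarrow> A y = Some v \<Longrightarrow> A (x - y) = Some (u - v)"
  using A_add[of x u "- y" "- v"] A_sc[of y v "- 1"] by simp

lemma A_zero: "A 0 = Some 0"
proof -
  have "0 \<in> dom A" using linear subspace_0 by (simp add: linear_op_def)
  then show ?thesis using A_diff[of 0 _ 0] by fastforce
qed

lemma subspace_ran: "subspace (ran A)"
  using A_zero A_add A_sc by (intro subspaceI) (fastforce simp: ran_def)+

lemma subspace_null_space: "subspace (null_space A)"
  using A_zero A_add A_sc by (intro subspaceI) (fastforce simp: null_space_def)+

lemma closed_null_space: "Topological_Spaces.closed (null_space A)"
proof -
  have "null_space A = (\<lambda>x. (x, 0)) -` Map.graph A"
    by (auto simp: null_space_def graph_def)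
  then show ?thesis
    using closed by (auto simp: closed_op_def intro!: closed_vimage continuous_intros)
qed

text \<open>Density makes \<open>z\<close> a limit of domain vectors, all orthogonal to
  \<open>z\<close>, so \<open>z\<close> is orthogonal to itself. This is the source of uniqueness
  for the adjoint.\<close>

lemma orth_dom_eq_0:
  assumes "\<And>x u. A x = Some u \<Longrightarrow> ip x z = 0"
  shows "z = 0"
proof -
  have "z \<in> closure (dom A)" using dense by (simp add: densely_defined_def)
  then obtain f where f: "\<And>n. f n \<in> dom A" "f \<longlonglongrightarrow> z"
    by (auto simp: closure_sequential)
  have "(\<lambda>n. ip (f n) z) \<longlonglongrightarrow> ip z z" by (intro tendsto_ip f(2) tendsto_const)
  moreover have "ip (f n) z = 0" for n using f(1)[of n] assms by blast
  ultimately have "ip z z = 0" by (simp add: LIMSEQ_const_iff)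
  then show ?thesis by (simp add: ip_self_eq_0_iff)
qed

text \<open>Two candidate values differ by a vector orthogonal to the domain and hence agree. The
  definite description is therefore proper and can be replaced by the defining identity from here
  on.\<close>

lemma adjoint_iff:
  "op_adjoint ip A y = Some z \<longleftrightarrow> (\<forall>x u. A x = Some u \<longrightarrow> ip u y = ip x z)"
proof -
  let ?P = "\<lambda>z. \<forall>x u. A x = Some u \<longrightarrow> ip u y = ip x z"
  have uniq: "z = z'" if "?P z" "?P z'" for z z'
    using orth_dom_eq_0[of "z - z'"] that by (simp add: ip_diff_right)
  have the: "(THE z. ?P z) = z" if "?P z" for z
    using that uniq by (intro the_equality) blast+
  show ?thesis
  proof
    assume "op_adjoint ip A y = Some z"
    then obtain z' where "?P z'" "z = (THE z. ?P z)"
      unfolding op_adjoint_def by (auto split: if_splits)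
    then show "?P z" using the by metis
  next
    assume "?P z"
    then show "op_adjoint ip A y = Some z"
      using the[of z] unfolding op_adjoint_def by auto
  qed
qed

lemma null_space_adjoint: "null_space (op_adjoint ip A) = orth_compl ip (ran A)"
  using ip_eq_0_sym by (auto simp: null_space_def adjoint_iff orth_compl_def ran_def)

lemma subspace_ran_adjoint: "subspace (ran (op_adjoint ip A))"
proof (rule subspaceI)
  show "0 \<in> ran (op_adjoint ip A)"
    using adjoint_iff[of 0 0] by (auto simp: ran_def)
next
  fix z z' assume "z \<in> ran (op_adjoint ip A)" "z' \<in> ran (op_adjoint ip A)"
  then obtain y y' where "op_adjoint ip A y = Some z" "op_adjoint ip A y' = Some z'"
    by (auto simp: ran_def)
  then have "op_adjoint ip A (y + y') = Some (z + z')"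
    unfolding adjoint_iff by (auto simp: ip_add_right)
  then show "z + z' \<in> ran (op_adjoint ip A)" by (auto simp: ran_def)
next
  fix c z assume "z \<in> ran (op_adjoint ip A)"
  then obtain y where "op_adjoint ip A y = Some z" by (auto simp: ran_def)
  then have "op_adjoint ip A (sc c y) = Some (sc c z)"
    unfolding adjoint_iff by (auto simp: ip_sc_right)
  then show "sc c z \<in> ran (op_adjoint ip A)" by (auto simp: ran_def)
qed

text \<open>Projecting \<open>(x, 0)\<close> onto the closed graph of \<open>A\<close> gives \<open>(a, A a)\<close> with
  \<open>A\<^sup>* (A a) = x - a\<close>; then \<open>x \<bottom> x - a\<close> forces \<open>x = a\<close> and \<open>A a = 0\<close>.\<close>

lemma orth_compl_ran_adjoint: "orth_compl ip (ran (op_adjoint ip A)) = null_space A"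
proof
  show "null_space A \<subseteq> orth_compl ip (ran (op_adjoint ip A))"
    by (fastforce simp: null_space_def orth_compl_def ran_def adjoint_iff)
  show "orth_compl ip (ran (op_adjoint ip A)) \<subseteq> null_space A"
  proof
    fix x assume x: "x \<in> orth_compl ip (ran (op_adjoint ip A))"
    let ?sc2 = "\<lambda>c (x, y). (sc c x, sc c y)"
    let ?ip2 = "\<lambda>(x, y) (x', y'). ip x x' + ip y y'"
    interpret H2: hilbert_space ?sc2 ?ip2 by (rule hilbert_space_prod)
    have sub: "H2.subspace (Map.graph A)"
      by (rule H2.subspaceI)
        (auto simp: graph_def zero_prod_def A_zero intro: A_add A_sc)
    have cl: "Topological_Spaces.closed (Map.graph A)"
      using closed by (simp add: closed_op_def)
    obtain a b where ab: "orth_proj ?ip2 (Map.graph A) (x, 0) = (a, b)" by force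
    have Aa: "A a = Some b"
      using H2.orth_proj_in[OF sub cl, of "(x, 0)"] ab by (simp add: graph_def)
    have orth: "ip (x - a) v = ip b w" if "A v = Some w" for v w
      using H2.orth_proj_diff[OF sub cl, of "(x, 0)"] ab that
      by (auto simp: orth_compl_def graph_def ip_minus_left)
    have "op_adjoint ip A b = Some (x - a)"
      unfolding adjoint_iff using orth ip_sconj by metis
    then have "x - a \<in> ran (op_adjoint ip A)" by (auto simp: ran_def)
    then have "ip (x - a) x = 0" using x ip_eq_0_sym by (auto simp: orth_compl_def)
    then have "ip (x - a) (x - a) = - ip b b"
      using orth[OF Aa] by (simp add: ip_diff_right)
    then have "(of_real ((norm (x - a))\<^sup>2 + (norm b)\<^sup>2) :: 'k) = of_real 0"
      unfolding ip_norm by simp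
    then have "(norm (x - a))\<^sup>2 + (norm b)\<^sup>2 = 0" unfolding of_real_eq_iff .
    then have "x = a" "b = 0" by (auto simp: add_nonneg_eq_0_iff)
    then show "x \<in> null_space A" using Aa by (simp add: null_space_def)
  qed
qed

text \<open>The adjoint has a closed graph because its defining identity survives limits in
  \<open>y\<close> and \<open>z\<close>.\<close>

lemma adjoint_tendsto:
  assumes "\<And>n. op_adjoint ip A (w n) = Some (z n)" "w \<longlonglongrightarrow> w'" "z \<longlonglongrightarrow> z'"
  shows "op_adjoint ip A w' = Some z'"
  unfolding adjoint_iff
proof (intro allI impI)
  fix x u assume "A x = Some u"
  then have "ip u (w n) = ip x (z n)" for n using assms(1) by (simp add: adjoint_iff)
  moreover have "(\<lambda>n. ip u (w n)) \<longlonglongrightarrow> ip u w'" "(\<lambda>n. ip x (z n)) \<longlonglongrightarrow> ip x z'"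
    using assms by (auto intro: tendsto_ip tendsto_const)
  ultimately show "ip u w' = ip x z'" using LIMSEQ_unique by simp
qed

text \<open>Projecting onto the complement of the null space subtracts a vector of the null space,
  which lies in the domain and is sent to 0.\<close>

lemma orth_proj_null_space_compl:
  assumes "A x = Some u"
  shows "A (orth_proj ip (orth_compl ip (null_space A)) x) = Some u"
proof -
  have "orth_proj ip (null_space A) x \<in> null_space A"
    by (intro orth_proj_in subspace_null_space closed_null_space)
  then show ?thesis
    using A_diff[OF assms, of _ 0] orth_proj_diff_eq[OF subspace_null_space closed_null_space]
    by (simp add: null_space_def)
qed

lemma orth_proj_in_carrier:
  "x \<in> dom A \<Longrightarrow> orth_proj ip (orth_compl ip (null_space A)) x \<in> op_carrier ip A"
  using orth_proj_null_space_compl orth_proj_in[OF subspace_orth_compl closed_orth_compl]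
  by (auto simp: op_carrier_def)

lemma carrier_inj:
  assumes "x \<in> op_carrier ip A" "y \<in> op_carrier ip A" "A x = A y"
  shows "x = y"
proof -
  have "x - y \<in> null_space A"
    using assms A_diff[of x _ y] by (fastforce simp: null_space_def op_carrier_def)
  moreover have "x - y \<in> orth_compl ip (null_space A)"
    using assms by (intro subspace_diff subspace_orth_compl) (auto simp: op_carrier_def)
  ultimately show ?thesis using orth_compl_inter by fastforce
qed

text \<open>Approximate a vector of the complement by domain vectors and project them: the
  projections lie in the carrier, and continuity makes them converge to the same vector.\<close>

lemma closure_carrier: "closure (op_carrier ip A) = orth_compl ip (null_space A)"
proof
  show "closure (op_carrier ip A) \<subseteq> orth_compl ip (null_space A)"
    by (intro closure_minimal closed_orth_compl) (auto simp: op_carrier_def)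
  show "orth_compl ip (null_space A) \<subseteq> closure (op_carrier ip A)"
  proof
    fix x assume x: "x \<in> orth_compl ip (null_space A)"
    have "x \<in> closure (dom A)" using dense by (simp add: densely_defined_def)
    then obtain f where f: "\<And>n. f n \<in> dom A" "f \<longlonglongrightarrow> x"
      by (auto simp: closure_sequential)
    let ?P = "orth_proj ip (orth_compl ip (null_space A))"
    have "(\<lambda>n. ?P (f n)) \<longlonglongrightarrow> ?P x"
      by (intro tendsto_orth_proj subspace_orth_compl closed_orth_compl f(2))
    moreover have "?P x = x"
      using x orth_proj_id_iff[OF subspace_orth_compl closed_orth_compl] by blast
    ultimately show "x \<in> closure (op_carrier ip A)"
      using orth_proj_in_carrier[OF f(1)] by (force simp: closure_sequential)
  qed
qed

end

section \<open>Closed range of the adjoint\<close>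

locale closed_range_operator = closed_dense_operator +
  assumes closed_ran: "Topological_Spaces.closed (ran A)"
begin

lemma adjoint_lower_bound:
  "\<exists>c\<ge>0. \<forall>w\<in>ran A. \<forall>z. op_adjoint ip A w = Some z \<longrightarrow> norm w \<le> c * norm z"
proof -
  define B where "B = {w \<in> ran A. \<exists>z. op_adjoint ip A w = Some z \<and> norm z \<le> 1}"
  have "\<exists>c. \<forall>w\<in>B. norm (ip y w) \<le> c" for y
  proof -
    \<comment> \<open>An element of \<open>ran A\<close> pairs with \<open>y\<close> exactly as with
      the projection of \<open>y\<close> onto \<open>ran A\<close>. A preimage \<open>x\<close> of
      that projection therefore bounds all of \<open>B\<close> at \<open>y\<close>, which gives
      pointwise boundedness on the whole space.\<close>
    obtain x where x: "A x = Some (orth_proj ip (ran A) y)"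
      using orth_proj_in[OF subspace_ran closed_ran, of y] by (auto simp: ran_def)
    have "norm (ip y w) \<le> norm x" if wB: "w \<in> B" for w
    proof -
      obtain z where w: "w \<in> ran A" "op_adjoint ip A w = Some z" "norm z \<le> 1"
        using wB by (auto simp: B_def)
      have "ip y w = ip x z"
        using ip_orth_proj_left[OF subspace_ran closed_ran w(1), of y] w(2) x
        by (simp add: adjoint_iff)
      also have "norm \<dots> \<le> norm x * norm z" by (rule Cauchy_Schwarz)
      also have "\<dots> \<le> norm x" using w(3) by (simp add: mult_left_le)
      finally show ?thesis .
    qed
    then show ?thesis by blast
  qed
  then obtain c where c: "c \<ge> 0" "\<And>w. w \<in> B \<Longrightarrow> norm w \<le> c"
    using uniform_boundedness[of B] by blast
  have "norm w \<le> c * norm z" if w: "w \<in> ran A" "op_adjoint ip A w = Some z" for w z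
  proof (cases "z = 0")
    case True
    then have "w \<in> orth_compl ip (ran A)"
      using w(2) null_space_adjoint by (auto simp: null_space_def)
    then have "w = 0" using w(1) orth_compl_inter by blast
    then show ?thesis using c by simp
  next
    case False
    \<comment> \<open>In this locale \<open>'a\<close> is the type of scalars. The factor
      \<open>?r\<close> normalizes \<open>z\<close> to norm 1, which places the rescaled
      \<open>w\<close> in \<open>B\<close>.\<close>
    let ?r = "of_real (inverse (norm z)) :: 'a"
    have "sc ?r w \<in> ran A" using subspace_ran w(1) by (rule subspace_scale)
    moreover have "op_adjoint ip A (sc ?r w) = Some (sc ?r z)"
      using w(2) by (simp add: adjoint_iff ip_sc_right)
    moreover have "norm (sc ?r z) = 1" unfolding sc_of_real using False by simp
    ultimately have "sc ?r w \<in> B" by (auto simp: B_def)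
    then have "norm (sc ?r w) \<le> c" by (rule c(2))
    then show ?thesis unfolding sc_of_real using False by (simp add: field_simps)
  qed
  then show ?thesis using c(1) by blast
qed

text \<open>Preimages can be chosen in \<open>ran A\<close>, where the lower bound makes preimages
  of a convergent sequence Cauchy; closedness of the adjoint then identifies the limit.\<close>

lemma closed_ran_adjoint: "Topological_Spaces.closed (ran (op_adjoint ip A))"
proof -
  obtain c where c: "c \<ge> 0"
    "\<And>w z. w \<in> ran A \<Longrightarrow> op_adjoint ip A w = Some z \<Longrightarrow> norm w \<le> c * norm z"
    using adjoint_lower_bound by blast
  have ex: "\<exists>w\<in>ran A. op_adjoint ip A w = Some z" if z: "z \<in> ran (op_adjoint ip A)" for z
  proof -
    obtain y where y: "op_adjoint ip A y = Some z" using z by (auto simp: ran_def)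
    let ?w = "orth_proj ip (ran A) y"
    \<comment> \<open>The component of \<open>y\<close> orthogonal to \<open>ran A\<close> lies in
      the null space of the adjoint, so it can be discarded.\<close>
    have "op_adjoint ip A (y - ?w) = Some 0"
      using orth_proj_diff[OF subspace_ran closed_ran, of y] null_space_adjoint
      by (auto simp: null_space_def)
    then have "op_adjoint ip A ?w = Some z"
      using y by (simp add: adjoint_iff ip_diff_right)
    then show ?thesis using orth_proj_in[OF subspace_ran closed_ran] by blast
  qed
  show ?thesis
  proof (rule closed_sequential_limits[THEN iffD2], intro allI impI)
    fix z l assume z: "(\<forall>n. z n \<in> ran (op_adjoint ip A)) \<and> z \<longlonglongrightarrow> l"
    then have "\<forall>n. \<exists>w. w \<in> ran A \<and> op_adjoint ip A w = Some (z n)" using ex by blast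
    then obtain w where w: "\<And>n. w n \<in> ran A" "\<And>n. op_adjoint ip A (w n) = Some (z n)"
      by metis
    have bound: "norm (w m - w n) \<le> c * norm (z m - z n)" for m n
      using w by (intro c(2) subspace_diff[OF subspace_ran])
        (auto simp: adjoint_iff ip_diff_right)
    have "Cauchy z" using z convergent_Cauchy convergent_def by blast
    have "Cauchy w"
    proof (rule CauchyI)
      fix e :: real assume e: "e > 0"
      \<comment> \<open>Dividing by \<open>c + 1\<close> covers the case
        \<open>c = 0\<close>.\<close>
      then have "e / (c + 1) > 0" using c(1) by simp
      then obtain N where N: "\<And>m n. m \<ge> N \<Longrightarrow> n \<ge> N \<Longrightarrow> norm (z m - z n) < e / (c + 1)"
        using CauchyD[OF \<open>Cauchy z\<close>] by blast
      have "norm (w m - w n) < e" if "m \<ge> N" "n \<ge> N" for m n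
      proof -
        have "norm (w m - w n) \<le> (c + 1) * norm (z m - z n)"
          using bound[of m n] norm_ge_zero[of "z m - z n"] unfolding distrib_right by linarith
        also have "\<dots> < e" using N[OF that] c(1) by (simp add: field_simps)
        finally show ?thesis .
      qed
      then show "\<exists>M. \<forall>m\<ge>M. \<forall>n\<ge>M. norm (w m - w n) < e" by blast
    qed
    then obtain w' where "w \<longlonglongrightarrow> w'" using Cauchy_convergent_iff convergent_def by blast
    then have "op_adjoint ip A w' = Some l" using adjoint_tendsto w(2) z by blast
    then show "l \<in> ran (op_adjoint ip A)" by (auto simp: ran_def)
  qed
qed

text \<open>The complement of the range of the adjoint is the null space of \<open>A\<close>;
  closedness of that range allows taking complements once more.\<close>

lemma ran_adjoint: "ran (op_adjoint ip A) = orth_compl ip (null_space A)"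
  using orth_compl_orth_compl[OF subspace_ran_adjoint closed_ran_adjoint]
  by (simp add: orth_compl_ran_adjoint)

section \<open>The Moore-Penrose inverse and the equivalent conditions\<close>

lemma mp_inverse_iff:
  "mp_inverse ip A y = Some x \<longleftrightarrow> x \<in> op_carrier ip A \<and> A x = Some (orth_proj ip (ran A) y)"
proof -
  let ?Q = "orth_proj ip (ran A)"
  \<comment> \<open>Since \<open>ran A\<close> is closed, every \<open>y\<close> splits along
    \<open>ran A\<close> and its complement, so the inverse is defined everywhere and the closure in
    its definition disappears.\<close>
  have "?Q y + (y - ?Q y) \<in> ran A + orth_compl ip (ran A)"
    by (intro set_plus_intro orth_proj_in orth_proj_diff subspace_ran closed_ran)
  then have mp: "mp_inverse ip A y = Some (THE x. x \<in> op_carrier ip A \<and> A x = Some (?Q y))"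
    by (simp add: mp_inverse_def closed_ran)
  obtain x' where "A x' = Some (?Q y)"
    using orth_proj_in[OF subspace_ran closed_ran, of y] by (auto simp: ran_def)
  \<comment> \<open>Projecting any preimage of \<open>?Q y\<close> onto the complement of the null
    space moves it into the carrier without changing its image; \<open>carrier_inj\<close> then
    gives uniqueness.\<close>
  then have x0: "\<exists>x0. x0 \<in> op_carrier ip A \<and> A x0 = Some (?Q y)"
    using orth_proj_null_space_compl orth_proj_in_carrier by blast
  have the: "(THE x. x \<in> op_carrier ip A \<and> A x = Some (?Q y)) = x0"
    if "x0 \<in> op_carrier ip A \<and> A x0 = Some (?Q y)" for x0
    using that carrier_inj by (intro the_equality) auto
  show ?thesis using mp the x0 by (metis option.inject)
qed

lemma null_space_mp_inverse: "null_space (mp_inverse ip A) = orth_compl ip (ran A)"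
proof -
  have "0 \<in> op_carrier ip A"
    using A_zero subspace_0[OF subspace_orth_compl] by (auto simp: op_carrier_def)
  then show ?thesis
    using orth_proj_zero_iff[OF subspace_ran closed_ran] A_zero
    by (auto simp: null_space_def mp_inverse_iff)
qed

lemma A_mp_inverse: "(A \<circ>\<^sub>m mp_inverse ip A) x = Some (orth_proj ip (ran A) x)"
proof -
  obtain v where v: "mp_inverse ip A x = Some v"
  proof -
    obtain x' where "A x' = Some (orth_proj ip (ran A) x)"
      using orth_proj_in[OF subspace_ran closed_ran, of x] by (auto simp: ran_def)
    then show thesis
      using that mp_inverse_iff orth_proj_null_space_compl orth_proj_in_carrier by blast
  qed
  then have "A v = Some (orth_proj ip (ran A) x)" by (simp only: mp_inverse_iff)
  then show ?thesis using v by (simp add: map_comp_def)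
qed

lemma mp_inverse_A:
  assumes "x \<in> dom A"
  shows "(mp_inverse ip A \<circ>\<^sub>m A) x = Some (orth_proj ip (orth_compl ip (null_space A)) x)"
proof -
  obtain u where u: "A x = Some u" using assms by blast
  then have "orth_proj ip (ran A) u = u"
    using orth_proj_id_iff[OF subspace_ran closed_ran] by (auto simp: ran_def)
  then have "mp_inverse ip A u = Some (orth_proj ip (orth_compl ip (null_space A)) x)"
    using orth_proj_null_space_compl[OF u] orth_proj_in_carrier[OF assms]
    by (simp add: mp_inverse_iff)
  then show ?thesis using u by (simp add: map_comp_def)
qed

text \<open>On \<open>dom A\<close> the two products are the projections onto \<open>ran A\<close>
  and onto the complement of the null space. Agreement on this dense set extends by continuity, and
  the projections determine their ranges.\<close>

lemma commutes_iff:
  "(\<forall>x\<in>dom A. (A \<circ>\<^sub>m mp_inverse ip A) x = (mp_inverse ip A \<circ>\<^sub>m A) x) \<longleftrightarrow>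
     orth_compl ip (null_space A) = ran A"
  (is "?comm \<longleftrightarrow> ?M = _")
proof
  assume comm: ?comm
  have eq: "orth_proj ip (ran A) x = orth_proj ip ?M x" for x
  proof -
    have "x \<in> closure (dom A)" using dense by (simp add: densely_defined_def)
    then obtain f where f: "\<And>n. f n \<in> dom A" "f \<longlonglongrightarrow> x"
      by (auto simp: closure_sequential)
    have "orth_proj ip (ran A) (f n) = orth_proj ip ?M (f n)" for n
      using bspec[OF comm f(1)[of n]] mp_inverse_A[OF f(1)[of n]]
      by (simp only: A_mp_inverse option.inject)
    moreover have "(\<lambda>n. orth_proj ip (ran A) (f n)) \<longlonglongrightarrow> orth_proj ip (ran A) x"
      by (intro tendsto_orth_proj subspace_ran closed_ran f(2))
    moreover have "(\<lambda>n. orth_proj ip ?M (f n)) \<longlonglongrightarrow> orth_proj ip ?M x"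
      by (intro tendsto_orth_proj subspace_orth_compl closed_orth_compl f(2))
    ultimately show ?thesis using LIMSEQ_unique by simp
  qed
  show "?M = ran A"
  proof (rule set_eqI)
    fix x
    show "x \<in> ?M \<longleftrightarrow> x \<in> ran A"
      using eq[of x] orth_proj_id_iff[OF subspace_ran closed_ran, of x]
        orth_proj_id_iff[OF subspace_orth_compl closed_orth_compl, of "null_space A" x]
      by simp
  qed
next
  assume "?M = ran A"
  then show ?comm using A_mp_inverse mp_inverse_A by simp
qed

lemma is_orth_sum_iff:
  "is_orth_sum ip UNIV (ran A) (null_space A) \<longleftrightarrow> orth_compl ip (null_space A) = ran A"
proof
  assume S: "is_orth_sum ip UNIV (ran A) (null_space A)"
  then have sub: "ran A \<subseteq> orth_compl ip (null_space A)"
    by (auto simp: is_orth_sum_def orth_compl_def)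
  moreover have "x \<in> ran A" if x: "x \<in> orth_compl ip (null_space A)" for x
  proof -
    \<comment> \<open>The summand \<open>n = x - r\<close> lies in the null space and, as
      \<open>ran A\<close> is orthogonal to it, also in its complement; hence
      \<open>x = r\<close>.\<close>
    obtain r n where rn: "r \<in> ran A" "n \<in> null_space A" "x = r + n"
      using S unfolding is_orth_sum_def by (metis UNIV_I set_plus_elim)
    then have "x - r \<in> orth_compl ip (null_space A)"
      using x sub by (intro subspace_diff[OF subspace_orth_compl]) auto
    then have "n = 0" using rn orth_compl_inter by simp
    then show ?thesis using rn by simp
  qed
  ultimately show "orth_compl ip (null_space A) = ran A" by blast
next
  assume eq: "orth_compl ip (null_space A) = ran A"
  have "x \<in> ran A + null_space A" for x
  proof -
    let ?p = "orth_proj ip (null_space A) x"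
    have "(x - ?p) + ?p \<in> ran A + null_space A"
      unfolding eq[symmetric]
      by (intro set_plus_intro orth_proj_in orth_proj_diff subspace_null_space closed_null_space)
    then show ?thesis by simp
  qed
  moreover have "ip x y = 0" if "x \<in> ran A" "y \<in> null_space A" for x y
    using that unfolding eq[symmetric] by (simp add: orth_compl_def)
  ultimately show "is_orth_sum ip UNIV (ran A) (null_space A)"
    by (auto simp: is_orth_sum_def)
qed

end

theorem theorem2p3:
  fixes sc :: "'k::real_or_complex \<Rightarrow> 'a::banach \<Rightarrow> 'a"
    and ip :: "'a \<Rightarrow> 'a \<Rightarrow> 'k"
    and A :: "'a \<rightharpoonup> 'a"
  assumes "hilbert_space sc ip"
    and "linear_op sc A"
    and "densely_defined A"
    and "closed_op A"
    and "closed (ran A)"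
  shows
    "(ran A = ran (op_adjoint ip A)
        \<longleftrightarrow> (\<forall>x\<in>dom A. (A \<circ>\<^sub>m mp_inverse ip A) x = (mp_inverse ip A \<circ>\<^sub>m A) x)) \<and>
     (ran A = ran (op_adjoint ip A)
        \<longleftrightarrow> null_space A = null_space (mp_inverse ip A)) \<and>
     (ran A = ran (op_adjoint ip A)
        \<longleftrightarrow> null_space A = null_space (op_adjoint ip A)) \<and>
     (ran A = ran (op_adjoint ip A)
        \<longleftrightarrow> orth_compl ip (null_space A) = ran A) \<and>
     (ran A = ran (op_adjoint ip A)
        \<longleftrightarrow> closure (op_carrier ip A) = ran A) \<and>
     (ran A = ran (op_adjoint ip A)
        \<longleftrightarrow> is_orth_sum ip UNIV (ran A) (null_space A))"
proof -
  interpret closed_range_operator sc ip A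
    using assms by (simp add: closed_range_operator_def closed_dense_operator_def
        closed_dense_operator_axioms_def closed_range_operator_axioms_def)
  \<comment> \<open>Both null space conditions rewrite to the left-hand side; taking complements of
    closed subspaces brings them to the form shared by the other conditions.\<close>
  have "null_space A = orth_compl ip (ran A) \<longleftrightarrow> orth_compl ip (null_space A) = ran A"
    using orth_compl_flip[OF subspace_null_space closed_null_space subspace_ran closed_ran] by simp
  then show ?thesis
    unfolding ran_adjoint commutes_iff null_space_mp_inverse null_space_adjoint closure_carrier
      is_orth_sum_iff
    by auto
qed

end
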